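(* Omitting a single entry from a permutation may decrease the cyclic breadth by at most one. That is, for every $n\ge 3$ and every $\sigma\in S_n$, if $\sigma'\in S_{n-1}$ is obtained from $\sigma$ by omitting one entry $\sigma_k$ ($1\le k\le n$) from its one-line notation and standardizing, then $cbr(\sigma')\ge cbr(\sigma)-1$.
   Context: $S_n$ is the set of permutations of $[n]=\{1,\dots,n\}$, written in one-line notation $\sigma=[\sigma_1,\dots,\sigma_n]$. Standardizing a sequence of $m$ distinct numbers means replacing it by the permutation in $S_m$ order-isomorphic to it. For $\sigma\in S_n$ and $1\le i<j\le n$ let $||j-i||=\min(j-i,\;n-j+i)$, and let the cyclic Manhattan distance be $cd_\sigma(i,j)=cd_\sigma(j,i)=|\sigma_j-\sigma_i|+||j-i||$. The cyclic breadth of $\sigma$ (for $n\ge 2$) is $cbr(\sigma)=\min_{i,j\in[n],\,i\ne j} cd_\sigma(i,j)$. *)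

theory Defs
  imports Complex_Main "HOL-Combinatorics.Multiset_Permutations"
begin

text \<open>
  Permutations in $S_n$ are their one-line notations, i.e. the lists in
  \<open>permutations_of_set {1..n}\<close>. Positions are 1-based, as on paper.
\<close>

definition entry :: "nat list \<Rightarrow> nat \<Rightarrow> nat" where
  "entry \<sigma> i = \<sigma> ! (i - 1)"

text \<open>
  The cyclic distance $\min(j-i, n-j+i)$ of positions $i<j$, written symmetrically
  in $i$ and $j$; integers avoid truncated subtraction.
\<close>

definition cyc_dist :: "nat \<Rightarrow> nat \<Rightarrow> nat \<Rightarrow> int" where
  "cyc_dist n i j = min \<bar>int j - int i\<bar> (int n - \<bar>int j - int i\<bar>)"

definition cd :: "nat list \<Rightarrow> nat \<Rightarrow> nat \<Rightarrow> int" where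
  "cd \<sigma> i j = \<bar>int (entry \<sigma> j) - int (entry \<sigma> i)\<bar> + cyc_dist (length \<sigma>) i j"

text \<open>Only meaningful for \<open>length \<sigma> \<ge> 2\<close>; otherwise the minimum is over the empty set.\<close>

definition cbr :: "nat list \<Rightarrow> int" where
  "cbr \<sigma> = Min {cd \<sigma> i j | i j. i \<in> {1..length \<sigma>} \<and> j \<in> {1..length \<sigma>} \<and> i \<noteq> j}"

definition order_isomorphic :: "nat list \<Rightarrow> nat list \<Rightarrow> bool" where
  "order_isomorphic xs ys \<longleftrightarrow> length xs = length ys \<and>
     (\<forall>i \<in> {1..length xs}. \<forall>j \<in> {1..length xs}.
        entry xs i < entry xs j \<longleftrightarrow> entry ys i < entry ys j)"

definition standardize :: "nat list \<Rightarrow> nat list" where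
  "standardize xs =
     (THE \<tau>. \<tau> \<in> permutations_of_set {1..length xs} \<and> order_isomorphic \<tau> xs)"

definition omit :: "nat \<Rightarrow> nat list \<Rightarrow> nat list" where
  "omit k \<sigma> = take (k - 1) \<sigma> @ drop k \<sigma>"

lemma order_isomorphic_nth:
  "order_isomorphic xs ys \<longleftrightarrow> length xs = length ys \<and>
     (\<forall>i<length xs. \<forall>j<length xs. xs ! i < xs ! j \<longleftrightarrow> ys ! i < ys ! j)"
proof -
  have "(\<forall>i \<in> {1..m}. P (i - 1)) \<longleftrightarrow> (\<forall>i<m. P i)" for P and m :: nat
  proof -
    have "{..<m} = (\<lambda>i. i - 1) ` {1..m}"
      by (auto simp: image_iff intro!: bexI[of _ "Suc _"])
    then show ?thesis by (metis imageE image_eqI lessThan_iff)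
  qed
  from this[of _ "\<lambda>i. \<forall>j\<in>{1..length xs}. xs ! i < xs ! (j-1) \<longleftrightarrow> ys ! i < ys ! (j-1)"]
    this[of _ "\<lambda>j. xs ! _ < xs ! j \<longleftrightarrow> ys ! _ < ys ! j"]
  show ?thesis unfolding order_isomorphic_def entry_def by simp
qed

lemma rank_of_permutation:
  assumes "\<tau> \<in> permutations_of_set {1..length xs}" "order_isomorphic \<tau> xs" "i < length xs"
  shows "\<tau> ! i = card {j. j < length xs \<and> xs ! j \<le> xs ! i}"
proof -
  have len: "length \<tau> = length xs" and st: "set \<tau> = {1..length xs}" and d: "distinct \<tau>"
    using assms by (auto simp: order_isomorphic_def permutations_of_set_def)
  have "\<tau> ! j \<le> \<tau> ! i \<longleftrightarrow> xs ! j \<le> xs ! i" if "j < length xs" for j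
    using assms that len unfolding order_isomorphic_nth by (metis linorder_not_less)
  then have eq: "{j. j < length xs \<and> xs ! j \<le> xs ! i} = {j. j < length \<tau> \<and> \<tau> ! j \<le> \<tau> ! i}"
    using len by auto
  have ti: "\<tau> ! i \<in> {1..length xs}"
    using assms(3) len st nth_mem by metis
  have "(!) \<tau> ` {j. j < length \<tau> \<and> \<tau> ! j \<le> \<tau> ! i} = {1..\<tau> ! i}"
  proof -
    have "(!) \<tau> ` {j. j < length \<tau> \<and> \<tau> ! j \<le> \<tau> ! i} = {x \<in> set \<tau>. x \<le> \<tau> ! i}"
      by (auto simp: set_conv_nth)
    also have "\<dots> = {1..\<tau> ! i}" using ti by (auto simp: st)
    finally show ?thesis .
  qed
  moreover have "inj_on ((!) \<tau>) {j. j < length \<tau> \<and> \<tau> ! j \<le> \<tau> ! i}"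
    using d by (auto simp: inj_on_def nth_eq_iff_index_eq)
  ultimately show ?thesis
    unfolding eq by (metis card_image card_atLeastAtMost diff_Suc_1)
qed

lemma standardize_ex1:
  assumes "distinct xs"
  shows "\<exists>!\<tau>. \<tau> \<in> permutations_of_set {1..length xs} \<and> order_isomorphic \<tau> xs"
proof (rule ex_ex1I)
  define r where "r x = card {y \<in> set xs. y \<le> x}" for x
  have less: "r x < r y" if "x < y" "y \<in> set xs" for x y
  proof -
    have "y \<in> {z \<in> set xs. z \<le> y} - {z \<in> set xs. z \<le> x}" using that by auto
    moreover have "{z \<in> set xs. z \<le> x} \<subseteq> {z \<in> set xs. z \<le> y}" using that by auto
    ultimately show ?thesis unfolding r_def by (intro psubset_card_mono) auto
  qed
  then have mono: "r x < r y \<longleftrightarrow> x < y" if "x \<in> set xs" "y \<in> set xs" for x y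
    using that by (metis linorder_less_linear order_less_imp_not_less less_irrefl)
  have inj: "inj_on r (set xs)"
    using mono by (metis inj_onI linorder_neq_iff)
  have sub: "r ` set xs \<subseteq> {1..length xs}"
  proof
    fix v assume "v \<in> r ` set xs"
    then obtain x where x: "x \<in> set xs" "v = r x" by auto
    have "r x \<le> card (set xs)" unfolding r_def by (intro card_mono) auto
    moreover have "r x > 0" unfolding r_def using x by (auto simp: card_gt_0_iff)
    ultimately show "v \<in> {1..length xs}" using x card_length[of xs] by auto
  qed
  have "r ` set xs = {1..length xs}"
    using sub by (rule card_subset_eq[rotated]) (auto simp: card_image[OF inj] distinct_card[OF assms])
  then show "\<exists>\<tau>. \<tau> \<in> permutations_of_set {1..length xs} \<and> order_isomorphic \<tau> xs"
    using assms inj mono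
    by (intro exI[of _ "map r xs"])
      (auto simp: permutations_of_set_def distinct_map order_isomorphic_nth)
next
  fix \<tau> \<tau>'
  assume a: "\<tau> \<in> permutations_of_set {1..length xs} \<and> order_isomorphic \<tau> xs"
    and b: "\<tau>' \<in> permutations_of_set {1..length xs} \<and> order_isomorphic \<tau>' xs"
  show "\<tau> = \<tau>'"
  proof (rule nth_equalityI)
    show "length \<tau> = length \<tau>'" using a b by (simp add: order_isomorphic_def)
    show "\<tau> ! i = \<tau>' ! i" if "i < length \<tau>" for i
    proof -
      have "i < length xs" using a that by (simp add: order_isomorphic_def)
      then show ?thesis using rank_of_permutation[of \<tau>] rank_of_permutation[of \<tau>'] a b by metis
    qed
  qed
qed

end

theory Submission
  imports Defs
begin

text \<open>
  Each of the two summands of the distance between two surviving entries drops by at most one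
  when \<open>\<sigma>\<^sub>k\<close> is omitted: the value difference drops only if \<open>\<sigma>\<^sub>k\<close> lies between the two values, and
  the cyclic distance of the positions drops only if \<open>k\<close> lies on a shortest arc between them
  (lemmas \<open>close_gap_diff_cases\<close> and \<open>cyc_dist_skip_cases\<close>). So the distance of a pair \<open>a, b\<close> drops
  by at most one unless both summands drop. In that exceptional case \<open>k\<close> is between \<open>a\<close> and \<open>b\<close> for
  both metrics, hence \<open>cd a k + cd k b \<le> cd a b\<close>, so \<open>cd a b\<close> is at least \<open>2 * cbr \<sigma>\<close>; as
  \<open>cbr \<sigma> \<ge> 1\<close>, a loss of two still leaves at least \<open>2 * cbr \<sigma> - 2 \<ge> cbr \<sigma> - 1\<close>.
\<close>

definition skip :: "nat \<Rightarrow> nat \<Rightarrow> nat" where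
  "skip k i = (if i < k then i else Suc i)"

definition close_gap :: "nat \<Rightarrow> nat \<Rightarrow> nat" where
  "close_gap c v = (if c < v then v - 1 else v)"

lemma skip_in_range:
  assumes "1 \<le> k" "k \<le> n" "i \<in> {1..n - 1}"
  shows "skip k i \<in> {1..n}" "skip k i \<noteq> k"
  using assms by (auto simp: skip_def)

lemma skip_inject: "skip k i = skip k j \<longleftrightarrow> i = j"
  by (auto simp: skip_def)

lemma close_gap_less_iff:
  assumes "x \<noteq> c" "y \<noteq> c"
  shows "close_gap c x < close_gap c y \<longleftrightarrow> x < y"
  using assms by (auto simp: close_gap_def)

lemma length_omit: "1 \<le> k \<Longrightarrow> k \<le> length \<sigma> \<Longrightarrow> length (omit k \<sigma>) = length \<sigma> - 1"
  by (auto simp: omit_def)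

lemma entry_omit:
  assumes "1 \<le> k" "k \<le> length \<sigma>" "i \<in> {1..length \<sigma> - 1}"
  shows "entry (omit k \<sigma>) i = entry \<sigma> (skip k i)"
  using assms by (auto simp: omit_def entry_def skip_def nth_append min_def)

lemma entry_eq_iff:
  assumes "distinct \<sigma>" "i \<in> {1..length \<sigma>}" "j \<in> {1..length \<sigma>}"
  shows "entry \<sigma> i = entry \<sigma> j \<longleftrightarrow> i = j"
  using assms by (auto simp: entry_def nth_eq_iff_index_eq)

lemma omit_set_distinct:
  assumes "distinct \<sigma>" "1 \<le> k" "k \<le> length \<sigma>"
  shows "set (omit k \<sigma>) = set \<sigma> - {entry \<sigma> k}" "distinct (omit k \<sigma>)"
proof -
  have split: "\<sigma> = take (k - 1) \<sigma> @ entry \<sigma> k # drop k \<sigma>"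
    using assms id_take_nth_drop[of "k - 1" \<sigma>] by (simp add: entry_def)
  with assms(1) have d: "distinct (take (k - 1) \<sigma> @ entry \<sigma> k # drop k \<sigma>)"
    by simp
  have "set \<sigma> = set (take (k - 1) \<sigma> @ entry \<sigma> k # drop k \<sigma>)"
    using split by simp
  then show "set (omit k \<sigma>) = set \<sigma> - {entry \<sigma> k}"
    using d by (auto simp: omit_def)
  show "distinct (omit k \<sigma>)"
    using d by (auto simp: omit_def)
qed

lemma image_close_gap:
  assumes "c \<in> {1..n}"
  shows "close_gap c ` ({1..n} - {c}) = {1..n - 1}"
proof
  show "close_gap c ` ({1..n} - {c}) \<subseteq> {1..n - 1}"
    using assms by (auto simp: close_gap_def)
  \<comment> \<open>\<open>skip c\<close> is the inverse of \<open>close_gap c\<close> away from \<open>c\<close>.\<close>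
  show "{1..n - 1} \<subseteq> close_gap c ` ({1..n} - {c})"
  proof
    fix v assume "v \<in> {1..n - 1}"
    then show "v \<in> close_gap c ` ({1..n} - {c})"
      using skip_in_range[of c n v] assms
      by (intro image_eqI[of _ _ "skip c v"]) (auto simp: close_gap_def skip_def)
  qed
qed

text \<open>
  The entries that survive the omission of \<open>\<sigma>\<^sub>k\<close> miss only the value \<open>\<sigma>\<^sub>k\<close>, so lowering the larger
  ones by one is the unique order-preserving way to make them a permutation.
\<close>

lemma standardize_omit:
  assumes "\<sigma> \<in> permutations_of_set {1..n}" "1 \<le> k" "k \<le> n"
  shows "standardize (omit k \<sigma>) = map (close_gap (entry \<sigma> k)) (omit k \<sigma>)"
proof -
  let ?c = "entry \<sigma> k" and ?xs = "omit k \<sigma>"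
  have set: "set \<sigma> = {1..n}" and d: "distinct \<sigma>"
    using assms by (auto simp: permutations_of_set_def)
  then have len: "length \<sigma> = n"
    using distinct_card by fastforce
  have c: "?c \<in> {1..n}"
    using assms len set nth_mem[of "k - 1" \<sigma>] by (simp add: entry_def)
  have sx: "set ?xs = {1..n} - {?c}" and dx: "distinct ?xs"
    using omit_set_distinct[OF d] assms len set by auto
  have lx: "length ?xs = n - 1"
    using assms len by (simp add: length_omit)
  have mono: "close_gap ?c x < close_gap ?c y \<longleftrightarrow> x < y" if "x \<in> set ?xs" "y \<in> set ?xs" for x y
    using that sx by (intro close_gap_less_iff) auto
  have "inj_on (close_gap ?c) (set ?xs)"
    using mono by (metis inj_onI linorder_neq_iff)
  then have "map (close_gap ?c) ?xs \<in> permutations_of_set {1..length ?xs}"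
    using dx sx image_close_gap[OF c] lx by (simp add: permutations_of_set_def distinct_map)
  moreover have "order_isomorphic (map (close_gap ?c) ?xs) ?xs"
    using mono by (simp add: order_isomorphic_nth)
  ultimately show ?thesis
    unfolding standardize_def using standardize_ex1[OF dx] by (intro the1_equality) auto
qed

text \<open>
  Closing the gap shortens an interval only if \<open>c\<close> lies inside it, and then \<open>c\<close> splits the
  interval additively.
\<close>

lemma close_gap_diff_cases:
  assumes "x \<noteq> c" "y \<noteq> c"
  defines "d' \<equiv> \<bar>int (close_gap c y) - int (close_gap c x)\<bar>" and "d \<equiv> \<bar>int y - int x\<bar>"
  shows "d' = d \<or> d' = d - 1 \<and> \<bar>int c - int x\<bar> + \<bar>int y - int c\<bar> = d"
  using assms(1,2) unfolding d'_def d_def close_gap_def by (auto split: if_splits)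

text \<open>
  Deleting the position \<open>k\<close> from the circle shortens the arc through \<open>k\<close> by one and keeps the other
  arc. The minimum therefore drops only if the arc through \<open>k\<close> is a shortest one.
\<close>

lemma cyc_dist_skip_cases:
  assumes "1 \<le> k" "k \<le> n" "i \<in> {1..n - 1}" "j \<in> {1..n - 1}" "i \<noteq> j"
  defines "d' \<equiv> cyc_dist (n - 1) i j" and "d \<equiv> cyc_dist n (skip k i) (skip k j)"
  shows "d' = d \<or>
    d' = d - 1 \<and> cyc_dist n (skip k i) k + cyc_dist n k (skip k j) \<le> d"
  using assms(1-5) unfolding d'_def d_def cyc_dist_def skip_def
  by (auto simp: min_def of_nat_diff abs_if split: if_splits)

lemma finite_cd_set:
  "finite {cd \<sigma> i j | i j. i \<in> {1..length \<sigma>} \<and> j \<in> {1..length \<sigma>} \<and> i \<noteq> j}"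
proof (rule finite_subset)
  show "{cd \<sigma> i j | i j. i \<in> {1..length \<sigma>} \<and> j \<in> {1..length \<sigma>} \<and> i \<noteq> j}
      \<subseteq> (\<lambda>(i, j). cd \<sigma> i j) ` ({1..length \<sigma>} \<times> {1..length \<sigma>})"
    by auto
qed simp

lemma cbr_le_cd:
  assumes "i \<in> {1..length \<sigma>}" "j \<in> {1..length \<sigma>}" "i \<noteq> j"
  shows "cbr \<sigma> \<le> cd \<sigma> i j"
  unfolding cbr_def using assms by (intro Min_le[OF finite_cd_set]) blast

lemma cbr_geI:
  assumes "2 \<le> length \<sigma>"
    and "\<And>i j. i \<in> {1..length \<sigma>} \<Longrightarrow> j \<in> {1..length \<sigma>} \<Longrightarrow> i \<noteq> j \<Longrightarrow> m \<le> cd \<sigma> i j"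
  shows "m \<le> cbr \<sigma>"
proof -
  have "(1::nat) \<in> {1..length \<sigma>}" "2 \<in> {1..length \<sigma>}" "(1::nat) \<noteq> 2"
    using assms(1) by auto
  then have "{cd \<sigma> i j | i j. i \<in> {1..length \<sigma>} \<and> j \<in> {1..length \<sigma>} \<and> i \<noteq> j} \<noteq> {}"
    by blast
  then show ?thesis
    unfolding cbr_def using assms(2) by (subst Min_ge_iff[OF finite_cd_set]) auto
qed

lemma cd_pos:
  assumes "i \<in> {1..length \<sigma>}" "j \<in> {1..length \<sigma>}" "i \<noteq> j"
  shows "1 \<le> cd \<sigma> i j"
  using assms by (auto simp: cd_def cyc_dist_def)

theorem proposition2p6:
  fixes n k :: nat and \<sigma> \<sigma>' :: "nat list"
  assumes "n \<ge> 3"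
    and "\<sigma> \<in> permutations_of_set {1..n}"
    and "1 \<le> k" and "k \<le> n"
    and "\<sigma>' = standardize (omit k \<sigma>)"
  shows "cbr \<sigma>' \<ge> cbr \<sigma> - 1"
proof -
  let ?c = "entry \<sigma> k"
  have d: "distinct \<sigma>" and len: "length \<sigma> = n"
    using assms(2) distinct_card[of \<sigma>] by (auto simp: permutations_of_set_def)
  have \<sigma>': "\<sigma>' = map (close_gap ?c) (omit k \<sigma>)"
    using assms standardize_omit by simp
  have len': "length \<sigma>' = n - 1"
    using \<sigma>' assms len by (simp add: length_omit)
  have pos: "1 \<le> cbr \<sigma>"
    using assms(1) len by (intro cbr_geI cd_pos) auto
  have entry': "entry \<sigma>' i = close_gap ?c (entry \<sigma> (skip k i))" if "i \<in> {1..n - 1}" for i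
  proof -
    have "entry \<sigma>' i = close_gap ?c (entry (omit k \<sigma>) i)"
    proof -
      have "i - 1 < length (omit k \<sigma>)"
        using that \<sigma>' len' by auto
      then show ?thesis
        by (simp add: entry_def \<sigma>')
    qed
    then show ?thesis
      using that assms len by (simp add: entry_omit)
  qed
  have "cbr \<sigma> - 1 \<le> cd \<sigma>' i j" if i: "i \<in> {1..n - 1}" and j: "j \<in> {1..n - 1}" and "i \<noteq> j" for i j
  proof -
    let ?a = "skip k i" and ?b = "skip k j"
    note a = skip_in_range[OF assms(3,4) i] and b = skip_in_range[OF assms(3,4) j]
    have k: "k \<in> {1..n}"
      using assms by simp
    have ab: "?a \<noteq> ?b"
      using \<open>i \<noteq> j\<close> by (simp add: skip_inject)
    have ne: "entry \<sigma> ?a \<noteq> ?c" "entry \<sigma> ?b \<noteq> ?c"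
      using entry_eq_iff[OF d, unfolded len] a b k by auto
    have cd': "cd \<sigma>' i j = \<bar>int (close_gap ?c (entry \<sigma> ?b)) - int (close_gap ?c (entry \<sigma> ?a))\<bar>
        + cyc_dist (n - 1) i j"
      using entry' i j len' by (simp add: cd_def)
    have min: "cbr \<sigma> \<le> cd \<sigma> ?a ?b" "cbr \<sigma> \<le> cd \<sigma> ?a k" "cbr \<sigma> \<le> cd \<sigma> k ?b"
      using a b k ab len by (auto intro!: cbr_le_cd)
    show ?thesis
      using close_gap_diff_cases[OF ne] cyc_dist_skip_cases[OF assms(3,4) i j \<open>i \<noteq> j\<close>]
        min[unfolded cd_def len] pos unfolding cd' by linarith
  qed
  then show ?thesis
    using assms(1) len' by (intro cbr_geI) auto
qed

end
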